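(* Let $SL(2,\mathbb{R})$ act continuously (on the left) on a locally compact, second countable Hausdorff space $X$, let $x\in X$, and let $I\subset\mathbb{T}=\mathbb{R}/2\pi\mathbb{Z}$ be a compact subinterval of positive length. Suppose that the weak* limit $$\mu:=\lim_{\pi\to\delta^I_\infty}\int_{[1,+\infty)\times I}\left(\frac1T\int_0^T(g_t\circ r_\theta)_*(\delta_x)\,dt\right)d\pi(T,\theta)$$ exists as $\pi$ varies over all compactly supported, absolutely continuous probability measures on $[1,+\infty)\times I$ with smooth density, and that $\mu$ is a $g_{\mathbb{R}}$-ergodic probability measure on $X$. Then for Lebesgue almost all $\theta\in I$ we have, in the weak* topology, $$\lim_{T\to+\infty}\frac1T\int_0^T(g_t\circ r_\theta)_*(\delta_x)\,dt=\mu .$$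
   Context: Notation: $g_t=\begin{pmatrix}e^t&0\\0&e^{-t}\end{pmatrix}$, $r_\theta=\begin{pmatrix}\cos\theta&\sin\theta\\-\sin\theta&\cos\theta\end{pmatrix}$, acting on $X$ through the given $SL(2,\mathbb{R})$-action. $\delta_x$ is the Dirac mass at $x$; $(g)_*$ is push-forward. $S_I$ is the one-point compactification of $[1,+\infty)\times I$ and $\delta^I_\infty$ is the Dirac mass at its point at infinity. The limit as $\pi\to\delta^I_\infty$ means: for every sequence $(\pi_n)$ of measures of the indicated class converging weak* to $\delta^I_\infty$ as measures on $S_I$, the corresponding measures on $X$ converge weak* to $\mu$. Weak* convergence of Borel measures on $X$ means convergence of integrals of every continuous compactly supported function. "$g_{\mathbb{R}}$-ergodic" means invariant and ergodic under the flow $(g_t)_{t\in\mathbb{R}}$. *)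

theory Defs
  imports "HOL-Probability.Probability"
begin

section \<open>The circle \<open>\<real> / 2\<pi>\<int>\<close>\<close>

quotient_type circle = real / "\<lambda>s t. \<exists>k::int. t = s + 2 * pi * of_int k"
proof (rule equivpI)
  show "reflp (\<lambda>s t. \<exists>k::int. t = s + 2 * pi * of_int k)"
    by (intro reflpI exI[of _ 0]) simp
  show "symp (\<lambda>s t. \<exists>k::int. t = s + 2 * pi * of_int k)"
  proof (rule sympI)
    fix s t :: real
    assume "\<exists>k::int. t = s + 2 * pi * of_int k"
    then obtain k :: int where "t = s + 2 * pi * of_int k" by blast
    then have "s = t + 2 * pi * of_int (- k)" by simp
    then show "\<exists>k::int. s = t + 2 * pi * of_int k" by blast
  qed
  show "transp (\<lambda>s t. \<exists>k::int. t = s + 2 * pi * of_int k)"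
  proof (rule transpI)
    fix s t u :: real
    assume "\<exists>k::int. t = s + 2 * pi * of_int k" "\<exists>k::int. u = t + 2 * pi * of_int k"
    then obtain k l :: int where "t = s + 2 * pi * of_int k" "u = t + 2 * pi * of_int l" by blast
    then have "u = s + 2 * pi * of_int (k + l)" by (simp add: algebra_simps)
    then show "\<exists>k::int. u = s + 2 * pi * of_int k" by blast
  qed
qed

instantiation circle :: topological_space
begin

definition open_circle :: "circle set \<Rightarrow> bool" where
  "open_circle U \<longleftrightarrow> open (abs_circle -` U)"

instance
proof
  show "open (UNIV :: circle set)" by (simp add: open_circle_def)
next
  fix U V :: "circle set"
  assume "open U" "open V"
  then show "open (U \<inter> V)" by (simp add: open_circle_def open_Int)
next
  fix K :: "circle set set"
  assume "\<forall>U\<in>K. open U"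
  then show "open (\<Union>K)" by (auto simp: open_circle_def vimage_Union)
qed

end

definition circle_lebesgue :: "circle measure" where
  "circle_lebesgue = distr (restrict_space lborel {0..<2 * pi}) borel abs_circle"

text \<open>Intervals are images of intervals of \<open>\<real>\<close>; an interval of length at least \<open>2\<pi>\<close> gives the
  whole circle.\<close>

definition compact_circle_interval :: "circle set \<Rightarrow> bool" where
  "compact_circle_interval I \<longleftrightarrow> (\<exists>a b. a < b \<and> I = abs_circle ` {a..b})"


section \<open>Continuous actions of \<open>SL(2,\<real>)\<close>\<close>

definition SL2R :: "(real^2^2) set" where
  "SL2R = {A. det A = 1}"

definition continuous_SL2R_action :: "(real^2^2 \<Rightarrow> 'x::topological_space \<Rightarrow> 'x) \<Rightarrow> bool" where
  "continuous_SL2R_action act \<longleftrightarrow>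
     (\<forall>y. act (mat 1) y = y) \<and>
     (\<forall>A\<in>SL2R. \<forall>B\<in>SL2R. \<forall>y. act (A ** B) y = act A (act B y)) \<and>
     continuous_on (SL2R \<times> UNIV) (\<lambda>(A, y). act A y)"

definition g_mat :: "real \<Rightarrow> real^2^2" where
  "g_mat t = vector [vector [exp t, 0], vector [0, exp (- t)]]"

lift_definition r_mat :: "circle \<Rightarrow> real^2^2" is
  "\<lambda>\<theta>. vector [vector [cos \<theta>, sin \<theta>], vector [- sin \<theta>, cos \<theta>]]"
proof -
  fix s t :: real
  assume "\<exists>k::int. t = s + 2 * pi * of_int k"
  then obtain k :: int where "t = s + 2 * pi * of_int k" by blast
  then have "sin t = sin s" "cos t = cos s"
    by (simp_all add: sin_add cos_add sin_int_2pin cos_int_2pin)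
  then show "(vector [vector [cos s, sin s], vector [- sin s, cos s]] :: real^2^2) =
      vector [vector [cos t, sin t], vector [- sin t, cos t]]"
    by simp
qed


section \<open>Measures and weak* convergence\<close>

definition borel_of :: "'a topology \<Rightarrow> 'a measure" where
  "borel_of S = sigma (topspace S) {U. openin S U}"

text \<open>On a compact space the support condition on test functions is vacuous.\<close>

definition weak_star_conv ::
    "'a topology \<Rightarrow> ('i \<Rightarrow> 'a measure) \<Rightarrow> 'a measure \<Rightarrow> 'i filter \<Rightarrow> bool" where
  "weak_star_conv S M N F \<longleftrightarrow>
     (\<forall>\<phi>. continuous_map S euclideanreal \<phi> \<and>
          (\<exists>K. compactin S K \<and> (\<forall>y\<in>topspace S - K. \<phi> y = 0)) \<longrightarrow>
          ((\<lambda>i. \<integral>y. \<phi> y \<partial>M i) \<longlongrightarrow> (\<integral>y. \<phi> y \<partial>N)) F)"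

definition flow_ergodic :: "(real \<Rightarrow> 'x::topological_space \<Rightarrow> 'x) \<Rightarrow> 'x measure \<Rightarrow> bool" where
  "flow_ergodic \<Phi> \<mu> \<longleftrightarrow>
     (\<forall>t. distr \<mu> borel (\<Phi> t) = \<mu>) \<and>
     (\<forall>A\<in>sets borel. (\<forall>t. \<Phi> t -` A = A) \<longrightarrow> emeasure \<mu> A = 0 \<or> emeasure \<mu> (UNIV - A) = 0)"

text \<open>Integrals of measure-valued functions against a probability measure are expressed by the
  monadic bind of the Giry monad; for \<open>T > 0\<close>, \<open>uniform_measure lborel {0..T}\<close> is \<open>dt / T\<close> on
  \<open>[0,T]\<close>.\<close>

definition orbit_average ::
    "(real^2^2 \<Rightarrow> 'x::topological_space \<Rightarrow> 'x) \<Rightarrow> 'x \<Rightarrow> real \<Rightarrow> circle \<Rightarrow> 'x measure" where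
  "orbit_average act x T \<theta> =
     uniform_measure lborel {0..T} \<bind>
       (\<lambda>t. distr (return borel x) borel (act (g_mat t) \<circ> act (r_mat \<theta>)))"

definition averaged_measure ::
    "(real^2^2 \<Rightarrow> 'x::topological_space \<Rightarrow> 'x) \<Rightarrow> 'x \<Rightarrow> (real \<times> circle) measure \<Rightarrow> 'x measure" where
  "averaged_measure act x \<pi> = \<pi> \<bind> (\<lambda>(T, \<theta>). orbit_average act x T \<theta>)"


section \<open>Measures on \<open>[1,\<infinity>) \<times> I\<close> and its one-point compactification\<close>

primrec C_k :: "nat \<Rightarrow> ('a::real_normed_vector \<Rightarrow> real) \<Rightarrow> bool" where
  "C_k 0 f \<longleftrightarrow> continuous_on UNIV f"
| "C_k (Suc k) f \<longleftrightarrow>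
     (\<forall>p. f differentiable (at p)) \<and> (\<forall>v. C_k k (\<lambda>p. frechet_derivative f (at p) v))"

definition smooth :: "('a::real_normed_vector \<Rightarrow> real) \<Rightarrow> bool" where
  "smooth f \<longleftrightarrow> (\<forall>k. C_k k f)"

text \<open>Smoothness on \<open>[1,\<infinity>) \<times> I\<close> is smoothness up to the boundary, i.e. existence of a smooth
  extension, in the angular coordinate of the universal cover \<open>\<real> \<rightarrow> \<real> / 2\<pi>\<int>\<close>.\<close>

definition smooth_on_strip :: "circle set \<Rightarrow> (real \<times> circle \<Rightarrow> real) \<Rightarrow> bool" where
  "smooth_on_strip I \<rho> \<longleftrightarrow>
     (\<exists>\<sigma>. smooth \<sigma> \<and> (\<forall>T\<ge>1. \<forall>\<theta>. abs_circle \<theta> \<in> I \<longrightarrow> \<rho> (T, abs_circle \<theta>) = \<sigma> (T, \<theta>)))"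

definition smooth_prob_measures :: "circle set \<Rightarrow> (real \<times> circle) measure set" where
  "smooth_prob_measures I =
     {\<pi>. prob_space \<pi> \<and>
         (\<exists>\<rho>. smooth_on_strip I \<rho> \<and> (\<forall>p\<in>{1..} \<times> I. 0 \<le> \<rho> p) \<and>
              \<pi> = density (restrict_space (lborel \<Otimes>\<^sub>M circle_lebesgue) ({1..} \<times> I)) (\<lambda>p. ennreal (\<rho> p))) \<and>
         (\<exists>K. compact K \<and> K \<subseteq> {1..} \<times> I \<and> (AE p in \<pi>. p \<in> K))}"

abbreviation S_compactification :: "circle set \<Rightarrow> (real \<times> circle) option topology" where
  "S_compactification I \<equiv> Alexandroff_compactification (top_of_set ({1..} \<times> I))"

definition tends_to_dirac_infinity ::
    "circle set \<Rightarrow> (nat \<Rightarrow> (real \<times> circle) measure) \<Rightarrow> bool" where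
  "tends_to_dirac_infinity I \<pi> \<longleftrightarrow>
     weak_star_conv (S_compactification I)
       (\<lambda>n. distr (\<pi> n) (borel_of (S_compactification I)) Some)
       (return (borel_of (S_compactification I)) None) sequentially"

end

theory Submission
  imports Defs
begin

text \<open>The admissible measures \<open>\<pi>\<close> include smooth bumps concentrated arbitrarily close to any
  prescribed point \<open>(T, \<theta>)\<close> of the strip. The integral of a test function \<open>\<phi>\<close> against the orbit
  average depends continuously on \<open>(T, \<theta>)\<close>. Hence, given \<open>\<theta> \<in> I\<close> and \<open>T\<^sub>n \<rightarrow> \<infinity>\<close>, one can choose
  bumps \<open>\<pi>\<^sub>n\<close> near \<open>(T\<^sub>n, \<theta>)\<close> whose averaged measures integrate \<open>\<phi>\<close> to within \<open>1/n\<close> of the orbit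
  average at \<open>(T\<^sub>n, \<theta>)\<close>. As \<open>\<pi>\<^sub>n\<close> tends to the Dirac mass at infinity, the hypothesis gives
  convergence of the orbit averages along \<open>T\<^sub>n\<close>, for every \<open>\<theta> \<in> I\<close>.\<close>

section \<open>Topology of the circle\<close>

lemma abs_circle_eq_iff: "abs_circle s = abs_circle t \<longleftrightarrow> (\<exists>k::int. t = s + 2 * pi * of_int k)"
  by (rule circle.abs_eq_iff)

lemma abs_circle_surj: obtains s where "\<theta> = abs_circle s"
  by (metis Quotient3_abs_rep Quotient3_circle)

lemma continuous_on_abs_circle: "continuous_on S abs_circle"
proof -
  have "continuous_on UNIV abs_circle"
    by (auto simp: continuous_on_open_vimage open_circle_def)
  then show ?thesis
    by (rule continuous_on_subset) simp
qed

text \<open>The saturation of an open set is the union of its translates by multiples of 2 pi, each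
  of which is open; so the quotient map is open.\<close>

lemma open_image_abs_circle:
  assumes "open S" shows "open (abs_circle ` S)"
proof -
  have "abs_circle -` (abs_circle ` S) = (\<Union>k::int. (\<lambda>s. s + 2 * pi * of_int k) ` S)"
  proof (intro equalityI subsetI)
    fix x assume "x \<in> abs_circle -` (abs_circle ` S)"
    then obtain s where "s \<in> S" "abs_circle s = abs_circle x" by auto
    then show "x \<in> (\<Union>k::int. (\<lambda>s. s + 2 * pi * of_int k) ` S)"
      unfolding abs_circle_eq_iff by auto
  next
    fix x assume "x \<in> (\<Union>k::int. (\<lambda>s. s + 2 * pi * of_int k) ` S)"
    then obtain k :: int and s where "s \<in> S" "x = s + 2 * pi * of_int k" by auto
    then have "abs_circle x = abs_circle s"
      by (metis abs_circle_eq_iff)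
    then show "x \<in> abs_circle -` (abs_circle ` S)"
      using \<open>s \<in> S\<close> by auto
  qed
  moreover have "open ((\<lambda>s. s + 2 * pi * of_int k) ` S)" for k :: int
    using open_translation[OF assms, of "2 * pi * of_int k"] by (simp add: add.commute)
  ultimately show ?thesis
    by (auto simp: open_circle_def)
qed

lemma r_mat_eq_lambda:
  "r_mat (abs_circle s) = (\<chi> i j. if i = j then cos s else if i = 1 then sin s else - sin s)"
  by (simp add: r_mat.abs_eq vec_eq_iff forall_2)

text \<open>Cosine and sine together determine an angle modulo 2 pi. Through this injection,
  matrices supply the circle with separation and with a usable distance.\<close>

lemma inj_r_mat: "inj r_mat"
proof (rule injI)
  fix \<theta> \<eta> assume *: "r_mat \<theta> = r_mat \<eta>"
  obtain s t where [simp]: "\<theta> = abs_circle s" "\<eta> = abs_circle t"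
    by (metis abs_circle_surj)
  have "sin t = sin s \<and> cos t = cos s"
    using * by (auto simp: r_mat_eq_lambda vec_eq_iff forall_2)
  then show "\<theta> = \<eta>"
    by (auto simp: sin_cos_eq_iff abs_circle_eq_iff mult.assoc)
qed

text \<open>By the quotient topology, continuity may be tested after composition with
  \<open>abs_circle\<close>, where the entries are trigonometric functions of a real
  variable.\<close>

lemma continuous_on_r_mat: "continuous_on S r_mat"
proof -
  have "continuous_on UNIV (\<lambda>s. r_mat (abs_circle s))"
    unfolding r_mat_eq_lambda
  proof (intro continuous_on_vec_lambda)
    fix i j :: 2
    show "continuous_on UNIV (\<lambda>s::real. if i = j then cos s else if i = 1 then sin s else - sin s)"
      by (cases "i = j"; cases "i = 1")
        (auto intro!: continuous_intros)
  qed
  then have "continuous_on UNIV r_mat"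
    by (simp add: continuous_on_open_vimage open_circle_def vimage_def)
  then show ?thesis
    by (rule continuous_on_subset) simp
qed

text \<open>Disjoint neighbourhoods of distinct matrices pull back along \<open>r_mat\<close>. In a
  Hausdorff circle the compact set \<open>I\<close> is closed, which makes the strip a Borel
  set.\<close>

instance circle :: t2_space
proof
  fix \<theta> \<eta> :: circle assume "\<theta> \<noteq> \<eta>"
  then have "r_mat \<theta> \<noteq> r_mat \<eta>"
    using inj_r_mat by (auto dest: injD)
  then obtain U V where "open U" "open V" "r_mat \<theta> \<in> U" "r_mat \<eta> \<in> V" "U \<inter> V = {}"
    by (metis hausdorff)
  then show "\<exists>U V. open U \<and> open V \<and> \<theta> \<in> U \<and> \<eta> \<in> V \<and> U \<inter> V = {}"
    using continuous_on_r_mat[of UNIV]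
    by (intro exI[of _ "r_mat -` U"] exI[of _ "r_mat -` V"]) (auto simp: continuous_on_open_vimage)
qed

text \<open>Since \<open>abs_circle\<close> is open, it carries a countable basis of the line to a
  basis. Second countability identifies product Borel sigma-algebras with the Borel sigma-algebra of
  the product.\<close>

instance circle :: second_countable_topology
proof
  obtain B :: "real set set" where B: "countable B" "topological_basis B"
    using ex_countable_basis by auto
  have "topological_basis ((`) abs_circle ` B)"
  proof (rule topological_basisI)
    fix W assume "W \<in> (`) abs_circle ` B"
    then show "open W"
      using B(2) by (auto simp: topological_basis_open intro!: open_image_abs_circle)
  next
    fix V and \<theta> :: circle assume V: "open V" "\<theta> \<in> V"
    obtain s where s: "\<theta> = abs_circle s" by (rule abs_circle_surj)
    have "open (abs_circle -` V)" "s \<in> abs_circle -` V"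
      using V s by (auto simp: open_circle_def)
    then obtain W where "W \<in> B" "s \<in> W" "W \<subseteq> abs_circle -` V"
      by (rule topological_basisE[OF B(2)])
    then show "\<exists>W'\<in>(`) abs_circle ` B. \<theta> \<in> W' \<and> W' \<subseteq> V"
      using s by (intro bexI[of _ "abs_circle ` W"]) auto
  qed
  then show "\<exists>B::circle set set. countable B \<and> open = generate_topology B"
    using B(1) by (intro exI[of _ "(`) abs_circle ` B"]) (auto simp: topological_basis_imp_subbasis)
qed

lemma compact_circle_interval_compact:
  assumes "compact_circle_interval I" shows "compact I"
  using assms unfolding compact_circle_interval_def
  by (auto intro!: compact_continuous_image continuous_on_abs_circle)

text \<open>An endpoint of \<open>I\<close> has neighbourhoods that leave \<open>I\<close>, but
  positive length puts every point of \<open>{a..b}\<close> in the closure of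
  \<open>{a<..<b}\<close>. This later guarantees that a bump centred at an endpoint has positive
  mass on the strip.\<close>

lemma open_meets_interior_circle_interval:
  assumes "compact_circle_interval I" "open U" "\<theta> \<in> U" "\<theta> \<in> I"
  obtains V where "open V" "V \<noteq> {}" "V \<subseteq> U \<inter> I"
proof -
  obtain a b where ab: "a < b" "I = abs_circle ` {a..b}"
    using assms(1) by (auto simp: compact_circle_interval_def)
  then obtain s where s: "s \<in> {a..b}" "\<theta> = abs_circle s"
    using assms(4) by auto
  let ?W = "abs_circle -` U \<inter> {a<..<b}"
  have o: "open (abs_circle -` U)"
    using assms(2) by (simp add: open_circle_def)
  have "s \<in> closure {a<..<b}"
    using ab s by simp
  moreover have "s \<in> abs_circle -` U"
    using s assms(3) by simp
  ultimately have "?W \<noteq> {}"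
    using o by (metis Int_commute closure_iff_nhds_not_empty order_refl)
  moreover have "open (abs_circle ` ?W)"
    using o by (intro open_image_abs_circle) auto
  ultimately show ?thesis
    using ab by (intro that[of "abs_circle ` ?W"]) auto
qed

section \<open>Lebesgue measure on the circle\<close>

lemma sets_circle_lebesgue [simp, measurable_cong]: "sets circle_lebesgue = sets borel"
  by (simp add: circle_lebesgue_def)

lemma space_circle_lebesgue [simp]: "space circle_lebesgue = UNIV"
  by (simp add: circle_lebesgue_def)

lemma emeasure_circle_lebesgue:
  assumes "A \<in> sets borel"
  shows "emeasure circle_lebesgue A = emeasure lborel ({0..<2 * pi} \<inter> abs_circle -` A)"
proof -
  have "abs_circle \<in> borel_measurable borel"
    by (intro borel_measurable_continuous_onI continuous_on_abs_circle)
  then have "abs_circle \<in> restrict_space lborel {0..<2 * pi} \<rightarrow>\<^sub>M borel"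
    by (intro measurable_restrict_space1) simp
  then show ?thesis
    using assms unfolding circle_lebesgue_def
    by (simp add: emeasure_distr emeasure_restrict_space space_restrict_space Int_commute)
qed

interpretation circle_lebesgue: finite_measure circle_lebesgue
  by standard (simp add: emeasure_circle_lebesgue)

lemma emeasure_circle_lebesgue_open:
  assumes "open V" "V \<noteq> {}"
  shows "emeasure circle_lebesgue V > 0"
proof -
  obtain s where s: "abs_circle s \<in> V"
    using assms(2) by (metis abs_circle_surj ex_in_conv)
  \<comment> \<open>\<open>t\<close> is the representative of the angle in the fundamental domain on
    which \<open>circle_lebesgue\<close> is defined.\<close>
  define t where "t = s - 2 * pi * of_int \<lfloor>s / (2 * pi)\<rfloor>"
  have "abs_circle t = abs_circle s"
    unfolding abs_circle_eq_iff t_def by (rule exI[of _ "\<lfloor>s / (2 * pi)\<rfloor>"]) simp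
  have t: "0 \<le> t" "t < 2 * pi"
    using floor_divide_lower[of "2 * pi" s] floor_divide_upper[of "2 * pi" s]
    by (auto simp: t_def algebra_simps)
  have "open (abs_circle -` V)" "t \<in> abs_circle -` V"
    using assms s \<open>abs_circle t = abs_circle s\<close> by (auto simp: open_circle_def)
  then obtain e where e: "e > 0" "ball t e \<subseteq> abs_circle -` V"
    by (meson open_contains_ball)
  \<comment> \<open>Only the half of the ball to the right of \<open>t\<close> is used, since
    \<open>t\<close> may be 0; cutting at 2 pi keeps it inside the fundamental domain.\<close>
  define d where "d = min (2 * pi) (t + e)"
  have "0 < emeasure lborel {t..<d}"
    using t e by (auto simp: d_def)
  also have "\<dots> \<le> emeasure lborel ({0..<2 * pi} \<inter> abs_circle -` V)"
  proof (rule emeasure_mono)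
    show "{t..<d} \<subseteq> {0..<2 * pi} \<inter> abs_circle -` V"
      using t e by (auto simp: d_def dist_real_def intro!: subsetD[OF e(2)])
    show "{0..<2 * pi} \<inter> abs_circle -` V \<in> sets lborel"
      using assms(1) by (auto simp: open_circle_def)
  qed
  finally show ?thesis
    using assms(1) by (simp add: emeasure_circle_lebesgue)
qed

section \<open>Smooth bump functions\<close>

text \<open>\<open>flat 0\<close> is the classical smooth function that vanishes on the negative
  half-line. The powers of \<open>1 / s\<close> are included because differentiation produces them,
  so the whole family is closed under derivatives.\<close>

definition flat :: "nat \<Rightarrow> real \<Rightarrow> real" where
  "flat n s = (if s > 0 then exp (- (1 / s)) / s ^ n else 0)"

lemma flat_nonneg: "0 \<le> flat n s"
  by (simp add: flat_def)

lemma flat_pos_iff: "0 < flat n s \<longleftrightarrow> 0 < s"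
  by (simp add: flat_def)

lemma flat_0_le_1: "flat 0 s \<le> 1"
  by (simp add: flat_def)

text \<open>On the right, the substitution \<open>y = 1 / s\<close> reduces the claim to the
  exponential outgrowing every power; on the left the function is zero.\<close>

lemma flat_tendsto_0: "(flat n \<longlongrightarrow> 0) (at 0)"
proof (rule filterlim_split_at)
  have "eventually (\<lambda>s. flat n s = 0) (at_left 0)"
    by (auto simp: flat_def eventually_at_left_field intro!: exI[of _ "-1"])
  then show "(flat n \<longlongrightarrow> 0) (at_left 0)"
    by (simp add: tendsto_eventually)
  have "((\<lambda>y. flat n (inverse y)) \<longlongrightarrow> 0) at_top"
  proof (rule Lim_transform_eventually[OF tendsto_power_div_exp_0[of n]])
    show "\<forall>\<^sub>F y in at_top. y ^ n / exp y = flat n (inverse y)"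
      using eventually_gt_at_top[of 0]
      by eventually_elim (simp add: flat_def exp_minus field_simps power_inverse)
  qed
  then show "(flat n \<longlongrightarrow> 0) (at_right 0)"
    by (simp add: filterlim_at_right_to_top)
qed

lemma flat_has_real_derivative:
  "(flat n has_real_derivative flat (n + 2) s - of_nat n * flat (n + 1) s) (at s)"
proof (cases s "0 :: real" rule: linorder_cases)
  case less
  have "((\<lambda>_. 0) has_real_derivative flat (n + 2) s - of_nat n * flat (n + 1) s) (at s)"
    using less by (simp add: flat_def)
  then show ?thesis
    by (rule has_field_derivative_transform_within_open[where S = "{..<0}"])
      (use less in \<open>auto simp: flat_def\<close>)
next
  case equal
  \<comment> \<open>Away from 0, the difference quotient of \<open>flat n\<close> at 0 is exactly
    \<open>flat (n + 1)\<close>.\<close>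
  have "((\<lambda>h. (flat n h - flat n 0) / (h - 0)) \<longlongrightarrow> 0) (at 0)"
    by (rule Lim_transform_eventually[OF flat_tendsto_0[of "n + 1"]])
      (auto simp: flat_def eventually_at_filter)
  then show ?thesis
    using equal by (simp add: has_field_derivative_iff flat_def)
next
  case greater
  let ?E = "exp (- (1 / s))"
  have "((\<lambda>s. exp (- (1 / s)) / s ^ n) has_real_derivative
      (?E * (1 / s\<^sup>2) * s ^ n - ?E * (of_nat n * s ^ (n - 1))) / (s ^ n * s ^ n)) (at s)"
    using greater by (auto intro!: derivative_eq_intros simp: power2_eq_square)
  moreover have "(?E * (1 / s\<^sup>2) * s ^ n - ?E * (of_nat n * s ^ (n - 1))) / (s ^ n * s ^ n) =
      flat (n + 2) s - of_nat n * flat (n + 1) s"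
    \<comment> \<open>Splitting off \<open>n = 0\<close> deals with the truncated exponent
      \<open>n - 1\<close>, which then carries the factor 0.\<close>
    using greater by (cases n) (auto simp: flat_def field_simps power2_eq_square)
  ultimately have "((\<lambda>s. exp (- (1 / s)) / s ^ n) has_real_derivative
      flat (n + 2) s - of_nat n * flat (n + 1) s) (at s)"
    by simp
  then show ?thesis
    by (rule has_field_derivative_transform_within_open[where S = "{0<..}"])
      (use greater in \<open>auto simp: flat_def\<close>)
qed

text \<open>This class is closed under directional derivatives, so its members are smooth.\<close>

inductive elementary :: "('a::real_normed_vector \<Rightarrow> real) \<Rightarrow> bool" where
  const: "elementary (\<lambda>_. c)"
| linear: "bounded_linear f \<Longrightarrow> elementary f"
| add: "elementary f \<Longrightarrow> elementary g \<Longrightarrow> elementary (\<lambda>p. f p + g p)"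
| mult: "elementary f \<Longrightarrow> elementary g \<Longrightarrow> elementary (\<lambda>p. f p * g p)"
| sin: "elementary f \<Longrightarrow> elementary (\<lambda>p. sin (f p))"
| cos: "elementary f \<Longrightarrow> elementary (\<lambda>p. cos (f p))"
| flat: "elementary f \<Longrightarrow> elementary (\<lambda>p. flat n (f p))"

lemmas elementary_closed =
  elementary.const elementary.add elementary.mult elementary.sin elementary.cos elementary.flat

lemma elementary_minus: "elementary f \<Longrightarrow> elementary (\<lambda>p. - f p)"
  using elementary.mult[OF elementary.const[of "- 1"]] by simp

lemma elementary_diff: "elementary f \<Longrightarrow> elementary g \<Longrightarrow> elementary (\<lambda>p. f p - g p)"
  using elementary.add[OF _ elementary_minus] by simp

text \<open>The derivative is kept as a function of the base point for a fixed direction, the shape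
  in which \<open>C_k\<close> iterates it.\<close>

lemma elementary_has_derivative:
  assumes "elementary f"
  shows "\<exists>f'. (\<forall>p. (f has_derivative f' p) (at p)) \<and> (\<forall>v. elementary (\<lambda>p. f' p v))"
  using assms
proof induction
  case (const c)
  then show ?case
    by (intro exI[of _ "\<lambda>_ _. 0"]) (auto intro: elementary.const)
next
  case (linear f)
  then show ?case
    by (intro exI[of _ "\<lambda>_. f"]) (auto intro: elementary.const bounded_linear_imp_has_derivative)
next
  case (add f g)
  then obtain f' g' where "\<forall>p. (f has_derivative f' p) (at p)" "\<forall>v. elementary (\<lambda>p. f' p v)"
      "\<forall>p. (g has_derivative g' p) (at p)" "\<forall>v. elementary (\<lambda>p. g' p v)"
    by blast
  then show ?case
    by (intro exI[of _ "\<lambda>p v. f' p v + g' p v"]) (auto intro!: derivative_intros elementary.add)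
next
  case (mult f g)
  then obtain f' g' where "\<forall>p. (f has_derivative f' p) (at p)" "\<forall>v. elementary (\<lambda>p. f' p v)"
      "\<forall>p. (g has_derivative g' p) (at p)" "\<forall>v. elementary (\<lambda>p. g' p v)"
    by blast
  with mult(1,2) show ?case
    by (intro exI[of _ "\<lambda>p v. f p * g' p v + f' p v * g p"])
      (auto intro!: has_derivative_mult elementary_closed)
next
  case (sin f)
  then obtain f' where f': "\<forall>p. (f has_derivative f' p) (at p)" "\<forall>v. elementary (\<lambda>p. f' p v)"
    by blast
  have "((\<lambda>p. sin (f p)) has_derivative (\<lambda>v. cos (f p) * f' p v)) (at p)" for p
    using f' by (auto intro!: derivative_eq_intros)
  with sin(1) f' show ?case
    by (intro exI[of _ "\<lambda>p v. cos (f p) * f' p v"]) (auto intro!: elementary_closed)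
next
  case (cos f)
  then obtain f' where f': "\<forall>p. (f has_derivative f' p) (at p)" "\<forall>v. elementary (\<lambda>p. f' p v)"
    by blast
  have "((\<lambda>p. cos (f p)) has_derivative (\<lambda>v. - (sin (f p) * f' p v))) (at p)" for p
    using f' by (auto intro!: derivative_eq_intros)
  with cos(1) f' show ?case
    by (intro exI[of _ "\<lambda>p v. - (sin (f p) * f' p v)"]) (auto intro!: elementary_minus elementary_closed)
next
  case (flat f n)
  then obtain f' where f': "\<forall>p. (f has_derivative f' p) (at p)" "\<forall>v. elementary (\<lambda>p. f' p v)"
    by blast
  let ?d = "\<lambda>s. flat (n + 2) s - of_nat n * flat (n + 1) s"
  have "((\<lambda>p. flat n (f p)) has_derivative (\<lambda>v. ?d (f p) * f' p v)) (at p)" for p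
    using has_derivative_compose[of f "f' p" p UNIV "flat n" "(*) (?d (f p))"] f'
      flat_has_real_derivative[of n "f p"]
    by (auto simp: has_field_derivative_def)
  with flat(1) f' show ?case
    by (intro exI[of _ "\<lambda>p v. ?d (f p) * f' p v"])
      (auto intro!: elementary_diff elementary_closed)
qed

lemma elementary_imp_smooth:
  assumes "elementary f" shows "smooth f"
  unfolding smooth_def
proof
  fix k show "C_k k f"
    using assms
  proof (induction k arbitrary: f)
    case 0
    then obtain f' where "\<forall>p. (f has_derivative f' p) (at p)"
      using elementary_has_derivative by blast
    then show ?case
      by (auto intro: continuous_at_imp_continuous_on has_derivative_continuous)
  next
    case (Suc k)
    then obtain f' where f': "\<forall>p. (f has_derivative f' p) (at p)" "\<forall>v. elementary (\<lambda>p. f' p v)"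
      using elementary_has_derivative by blast
    then have "frechet_derivative f (at p) = f' p" for p
      using frechet_derivative_at by (metis)
    with f' Suc.IH show ?case
      by (auto simp: differentiable_def)
  qed
qed

section \<open>Orbit averages\<close>

lemma continuous_on_g_mat: "continuous_on S g_mat"
proof -
  have *: "g_mat t = (\<chi> i j. if i = j then (if i = 1 then exp t else exp (- t)) else 0)" for t
    by (simp add: g_mat_def vec_eq_iff forall_2)
  have "continuous_on S (\<lambda>t::real. if i = j then (if i = 1 then exp t else exp (- t)) else 0)"
    for i j :: 2
    by (cases "i = j"; cases "i = 1") (auto intro!: continuous_intros)
  then show ?thesis
    unfolding * by (intro continuous_on_vec_lambda) auto
qed

lemma g_mat_SL2R: "g_mat t \<in> SL2R"
  by (simp add: SL2R_def g_mat_def det_2 flip: exp_add)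

lemma r_mat_SL2R: "r_mat \<theta> \<in> SL2R"
proof -
  obtain s where "\<theta> = abs_circle s" by (rule abs_circle_surj)
  then show ?thesis
    by (simp add: SL2R_def r_mat_eq_lambda det_2 flip: power2_eq_square)
qed

lemma SL2R_mult: "A \<in> SL2R \<Longrightarrow> B \<in> SL2R \<Longrightarrow> A ** B \<in> SL2R"
  by (simp add: SL2R_def det_mul)

lemma continuous_on_matrix_mult [continuous_intros]:
  fixes f :: "'a::topological_space \<Rightarrow> real^'n^'m" and g :: "'a \<Rightarrow> real^'k^'n"
  assumes "continuous_on S f" "continuous_on S g"
  shows "continuous_on S (\<lambda>p. f p ** g p)"
  unfolding matrix_matrix_mult_def
  by (intro continuous_on_vec_lambda continuous_intros assms)

lemma continuous_on_action:
  assumes "continuous_SL2R_action act"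
    and "continuous_on S f" "continuous_on S g" "\<And>p. p \<in> S \<Longrightarrow> f p \<in> SL2R"
  shows "continuous_on S (\<lambda>p. act (f p) (g p))"
proof -
  have "continuous_on (SL2R \<times> UNIV) (\<lambda>(A, y). act A y)"
    using assms(1) by (simp add: continuous_SL2R_action_def)
  from continuous_on_compose2[OF this, of S "\<lambda>p. (f p, g p)"] show ?thesis
    using assms(2-) by (auto intro!: continuous_intros)
qed

text \<open>The substitution \<open>t = T * u\<close>. It moves the dependence on \<open>T\<close>
  from the measure into the integrand, where continuity can be applied.\<close>

lemma uniform_measure_scale:
  fixes T :: real
  assumes "T > 0"
  shows "uniform_measure lborel {0..T} = distr (uniform_measure lborel {0..1}) borel ((*) T)"
proof (rule measure_eqI)
  fix A assume "A \<in> sets (uniform_measure lborel {0..T})"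
  then have [measurable]: "A \<in> sets borel" by simp
  have "emeasure lborel ({0..T} \<inter> A) = (\<integral>\<^sup>+s. indicator ({0..T} \<inter> A) s \<partial>lborel)"
    by simp
  also have "\<dots> = ennreal T * (\<integral>\<^sup>+u. indicator ({0..T} \<inter> A) (0 + T * u) \<partial>lborel)"
    using assms nn_integral_real_affine[of "indicator ({0..T} \<inter> A)" T 0] by simp
  also have "(\<integral>\<^sup>+u. indicator ({0..T} \<inter> A) (0 + T * u) \<partial>lborel) =
      (\<integral>\<^sup>+u. indicator ({0..1} \<inter> (*) T -` A) u \<partial>lborel)"
    using assms
    by (intro nn_integral_cong) (auto simp: indicator_def zero_le_mult_iff mult_le_cancel_left1)
  also have "\<dots> = emeasure lborel ({0..1} \<inter> (*) T -` A)"
    by (intro nn_integral_indicator) (auto intro!: measurable_sets_borel[of _ borel])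
  finally have "emeasure lborel ({0..T} \<inter> A) / ennreal T = emeasure lborel ({0..1} \<inter> (*) T -` A)"
    using assms by (simp add: ennreal_mult_divide_eq mult.commute[of "ennreal T"])
  then show "emeasure (uniform_measure lborel {0..T}) A =
      emeasure (distr (uniform_measure lborel {0..1}) borel ((*) T)) A"
    using assms measurable_sets_borel[of "(*) T" borel A]
    by (simp add: emeasure_distr emeasure_uniform_measure divide_ennreal_def)
qed simp

lemma prob_space_uniform_unit_interval: "prob_space (uniform_measure lborel {0..1::real})"
  by (rule prob_space_uniform_measure) auto

text \<open>Time is rescaled to the unit interval, and the angle is replaced by its rotation matrix
  so that the parameter \<open>z\<close> lives in a metric space.\<close>

definition renormalized_orbit ::
    "(real^2^2 \<Rightarrow> 'x \<Rightarrow> 'x) \<Rightarrow> 'x \<Rightarrow> real \<times> (real^2^2) \<Rightarrow> real \<Rightarrow> 'x" where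
  "renormalized_orbit act x z u = act (g_mat (fst z * u) ** snd z) x"

text \<open>The gauge integral is chosen because continuity in the parameter \<open>z\<close> then
  follows from the theorem on parameter integrals over a compact box.\<close>

definition time_average ::
    "(real^2^2 \<Rightarrow> 'x \<Rightarrow> 'x) \<Rightarrow> 'x \<Rightarrow> ('x \<Rightarrow> real) \<Rightarrow> real \<times> (real^2^2) \<Rightarrow> real" where
  "time_average act x \<phi> z = integral {0..1} (\<lambda>u. \<phi> (renormalized_orbit act x z u))"

lemma continuous_on_renormalized_orbit:
  assumes "continuous_SL2R_action act"
    and "continuous_on S f" "continuous_on S h" "\<And>p. p \<in> S \<Longrightarrow> snd (f p) \<in> SL2R"
  shows "continuous_on S (\<lambda>p. renormalized_orbit act x (f p) (h p))"
  unfolding renormalized_orbit_def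
  using assms(2-)
  by (intro continuous_on_action[OF assms(1)] continuous_intros
      continuous_on_compose2[OF continuous_on_g_mat[of UNIV]])
    (auto intro: SL2R_mult g_mat_SL2R)

text \<open>Pushing a Dirac mass forward gives the Dirac mass at the moved point, so the bind
  collapses to the image of uniform time under the orbit map.\<close>

lemma orbit_average_eq:
  fixes act :: "real^2^2 \<Rightarrow> 'x::{second_countable_topology, t2_space} \<Rightarrow> 'x"
  assumes act: "continuous_SL2R_action act" and "T > 0"
  shows "orbit_average act x T \<theta> =
    distr (uniform_measure lborel {0..1}) borel (renormalized_orbit act x (T, r_mat \<theta>))"
proof -
  have [measurable]: "act A \<in> borel_measurable borel" if "A \<in> SL2R" for A
    using that by (intro borel_measurable_continuous_onI continuous_on_action[OF act] continuous_intros)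
  have orb: "(\<lambda>t. act (g_mat t) (act (r_mat \<theta>) x)) \<in> borel_measurable borel"
    by (intro borel_measurable_continuous_onI continuous_on_action[OF act] continuous_on_g_mat
        g_mat_SL2R continuous_intros)
  have "distr (return borel x) borel (act (g_mat t) \<circ> act (r_mat \<theta>)) =
      return borel (act (g_mat t) (act (r_mat \<theta>) x))" for t
    using measurable_comp[of "act (r_mat \<theta>)" borel borel "act (g_mat t)" borel]
    by (subst distr_return) (auto simp: g_mat_SL2R r_mat_SL2R)
  then have "orbit_average act x T \<theta> =
      distr (uniform_measure lborel {0..T}) borel (\<lambda>t. act (g_mat t) (act (r_mat \<theta>) x))"
    using orb unfolding orbit_average_def by (simp add: bind_return_distr')
  also have "\<dots> = distr (uniform_measure lborel {0..1}) borel
      (\<lambda>u. act (g_mat (T * u)) (act (r_mat \<theta>) x))"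
    using orb by (simp add: uniform_measure_scale[OF assms(2)] distr_distr comp_def)
  also have "(\<lambda>u. act (g_mat (T * u)) (act (r_mat \<theta>) x)) =
      renormalized_orbit act x (T, r_mat \<theta>)"
    using act by (auto simp: renormalized_orbit_def continuous_SL2R_action_def g_mat_SL2R r_mat_SL2R)
  finally show ?thesis .
qed

lemma continuous_on_time_average:
  fixes act :: "real^2^2 \<Rightarrow> 'x::topological_space \<Rightarrow> 'x"
  assumes "continuous_SL2R_action act" "continuous_on UNIV \<phi>"
  shows "continuous_on (UNIV \<times> SL2R) (time_average act x \<phi>)"
proof -
  have "continuous_on ((UNIV \<times> SL2R) \<times> cbox 0 1) (\<lambda>(z, u). \<phi> (renormalized_orbit act x z u))"
    unfolding case_prod_unfold
    by (intro continuous_on_compose2[OF assms(2)] continuous_on_renormalized_orbit[OF assms(1)]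
        continuous_intros) auto
  from integral_continuous_on_param[OF this] show ?thesis
    by (simp add: time_average_def[abs_def])
qed

lemma integral_orbit_average:
  fixes act :: "real^2^2 \<Rightarrow> 'x::{second_countable_topology, t2_space} \<Rightarrow> 'x"
  assumes act: "continuous_SL2R_action act" and "T > 0" and \<phi>: "continuous_on UNIV \<phi>"
  shows "(\<integral>y. \<phi> y \<partial>orbit_average act x T \<theta>) = time_average act x \<phi> (T, r_mat \<theta>)"
proof -
  let ?c = "renormalized_orbit act x (T, r_mat \<theta>)"
  have c: "continuous_on UNIV ?c"
    by (intro continuous_on_renormalized_orbit[OF act] continuous_intros) (simp add: r_mat_SL2R)
  have \<phi>c: "continuous_on UNIV (\<lambda>u. \<phi> (?c u))"
    by (rule continuous_on_compose2[OF \<phi> c]) simp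
  have [measurable]: "?c \<in> borel_measurable borel" "\<phi> \<in> borel_measurable borel"
    "(\<lambda>u. \<phi> (?c u)) \<in> borel_measurable borel"
    using c \<phi> \<phi>c by (auto intro: borel_measurable_continuous_onI)
  have "(\<integral>y. \<phi> y \<partial>orbit_average act x T \<theta>) = (\<integral>u. \<phi> (?c u) \<partial>uniform_measure lborel {0..1})"
    using assms by (simp add: orbit_average_eq integral_distr)
  \<comment> \<open>The unit interval has measure 1, so no normalising factor remains and the
    expectation becomes a set integral.\<close>
  also have "uniform_measure lborel {0..1} = density lborel (\<lambda>u::real. ennreal (indicator {0..1} u))"
    by (auto simp: uniform_measure_def divide_ennreal_def ennreal_indicator intro!: density_cong)
  also have "(\<integral>u. \<phi> (?c u) \<partial>\<dots>) = (LINT u:{0..1}|lborel. \<phi> (?c u))"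
    by (subst integral_density) (auto simp: set_lebesgue_integral_def)
  also have "\<dots> = time_average act x \<phi> (T, r_mat \<theta>)"
    unfolding time_average_def
    by (intro set_borel_integral_eq_integral(2) borel_integrable_compact[unfolded set_integrable_def[symmetric]])
      (auto intro: continuous_on_subset[OF \<phi>c])
  finally show ?thesis .
qed

section \<open>Averages over the strip\<close>

lemma sets_lborel_circle: "sets (lborel \<Otimes>\<^sub>M circle_lebesgue) = sets borel"
  by (metis borel_prod sets_circle_lebesgue sets_lborel sets_pair_measure_cong)

lemma sets_smooth_prob_measure:
  assumes "\<pi> \<in> smooth_prob_measures I"
  shows "sets \<pi> = sets (restrict_space borel ({1..} \<times> I))"
proof -
  have "sets \<pi> = sets (restrict_space (lborel \<Otimes>\<^sub>M circle_lebesgue) ({1..} \<times> I))"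
    using assms by (auto simp: smooth_prob_measures_def)
  then show ?thesis
    by (simp only: sets_restrict_space sets_lborel_circle)
qed

lemma space_smooth_prob_measure:
  "\<pi> \<in> smooth_prob_measures I \<Longrightarrow> space \<pi> = {1..} \<times> I"
  using sets_eq_imp_space_eq[OF sets_smooth_prob_measure] by (simp add: space_restrict_space)

lemma measurable_smooth_prob_measure:
  assumes "\<pi> \<in> smooth_prob_measures I" "f \<in> borel \<rightarrow>\<^sub>M N"
  shows "f \<in> \<pi> \<rightarrow>\<^sub>M N"
  using measurable_restrict_space1[OF assms(2)]
  by (simp only: measurable_cong_sets[OF sets_smooth_prob_measure[OF assms(1)] refl])

text \<open>Integration against a bind is iterated integration, once the orbit averages are known to
  form a measurable kernel on the strip.\<close>

lemma integral_averaged_measure: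
  fixes act :: "real^2^2 \<Rightarrow> 'x::{second_countable_topology, t2_space} \<Rightarrow> 'x"
  assumes act: "continuous_SL2R_action act" and \<pi>: "\<pi> \<in> smooth_prob_measures I"
    and \<phi>: "continuous_on UNIV \<phi>" "\<And>y. \<bar>\<phi> y\<bar> \<le> B"
  shows "(\<integral>y. \<phi> y \<partial>averaged_measure act x \<pi>) =
    (\<integral>p. time_average act x \<phi> (fst p, r_mat (snd p)) \<partial>\<pi>)"
proof -
  let ?U = "uniform_measure lborel {0..1::real}"
  let ?c = "\<lambda>p. renormalized_orbit act x (fst p, r_mat (snd p))"
  interpret U: prob_space ?U by (rule prob_space_uniform_unit_interval)
  interpret \<pi>: prob_space \<pi> using \<pi> by (simp add: smooth_prob_measures_def)
  \<comment> \<open>Joint continuity in the strip point and the rescaled time gives joint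
    measurability, from which \<open>measurable_distr2\<close> produces a measurable kernel.\<close>
  have "continuous_on UNIV (case_prod ?c)"
    unfolding case_prod_unfold
    by (intro continuous_on_renormalized_orbit[OF act] continuous_intros
        continuous_on_compose2[OF continuous_on_r_mat[of UNIV]]) (auto simp: r_mat_SL2R)
  then have "case_prod ?c \<in> borel_measurable borel"
    by (rule borel_measurable_continuous_onI)
  moreover have "sets (borel \<Otimes>\<^sub>M ?U) = sets (borel :: ((real \<times> circle) \<times> real) measure)"
    by (metis borel_prod sets_lborel sets_pair_measure_cong sets_uniform_measure)
  ultimately have "case_prod ?c \<in> borel \<Otimes>\<^sub>M ?U \<rightarrow>\<^sub>M borel"
    by (simp cong: measurable_cong_sets)
  then have "(\<lambda>p. distr ?U borel (?c p)) \<in> borel \<rightarrow>\<^sub>M subprob_algebra borel"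
    by (rule measurable_distr2)
      (simp add: space_subprob_algebra U.subprob_space_axioms)
  then have "(\<lambda>p. distr ?U borel (?c p)) \<in> \<pi> \<rightarrow>\<^sub>M subprob_algebra borel"
    by (rule measurable_smooth_prob_measure[OF \<pi>])
  \<comment> \<open>Every point of \<open>space \<pi>\<close> has time at least 1, so the formula
    for positive times applies there.\<close>
  moreover have orb: "(\<lambda>(T, \<theta>). orbit_average act x T \<theta>) p = distr ?U borel (?c p)"
    if "p \<in> space \<pi>" for p
    using that \<pi> act by (auto simp: space_smooth_prob_measure orbit_average_eq)
  ultimately have ker: "(\<lambda>(T, \<theta>). orbit_average act x T \<theta>) \<in> \<pi> \<rightarrow>\<^sub>M subprob_algebra borel"
    by (simp cong: measurable_cong)
  have "(\<integral>y. \<phi> y \<partial>averaged_measure act x \<pi>) =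
      (\<integral>p. (\<integral>y. \<phi> y \<partial>(\<lambda>(T, \<theta>). orbit_average act x T \<theta>) p) \<partial>\<pi>)"
    unfolding averaged_measure_def
  proof (rule integral_bind[OF _ _ ker, where B = B and B' = 1])
    show "AE p in \<pi>. emeasure ((\<lambda>(T, \<theta>). orbit_average act x T \<theta>) p)
        (space ((\<lambda>(T, \<theta>). orbit_average act x T \<theta>) p)) \<le> ennreal 1"
      using subprob_space.emeasure_space_le_1[OF subprob_space_kernel[OF ker]] by (intro AE_I2) simp
  qed (use \<phi> in \<open>auto intro: borel_measurable_continuous_onI \<pi>.finite_measure_axioms\<close>)
  also have "\<dots> = (\<integral>p. time_average act x \<phi> (fst p, r_mat (snd p)) \<partial>\<pi>)"
    using \<pi> act \<phi> by (intro Bochner_Integration.integral_cong)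
      (auto simp: space_smooth_prob_measure integral_orbit_average)
  finally show ?thesis .
qed

lemma (in prob_space) expectation_close:
  fixes f :: "'a \<Rightarrow> real"
  assumes "f \<in> borel_measurable M" "AE p in M. \<bar>f p - c\<bar> \<le> e"
  shows "\<bar>expectation f - c\<bar> \<le> e"
proof -
  have "integrable M f"
    by (rule integrable_const_bound[where B = "\<bar>c\<bar> + e"]) (use assms in auto)
  moreover have "AE p in M. c - e \<le> f p" "AE p in M. f p \<le> c + e"
    using assms(2) by (eventually_elim; simp add: abs_le_iff)+
  ultimately have "c - e \<le> expectation f" "expectation f \<le> c + e"
    using integral_ge_const integral_le_const by blast+
  then show ?thesis by (simp add: abs_le_iff)
qed

section \<open>Measures concentrated near a point of the strip\<close>

text \<open>Measuring angular distance between the matrices \<open>r_mat \<theta>\<close> makes its square a smooth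
  \<open>2\<pi>\<close>-periodic function of the lifted angle, so the bump descends to the circle.\<close>

lemma dist_r_mat:
  "(dist (T, r_mat (abs_circle s)) (T0, r_mat (abs_circle s0)))\<^sup>2 =
    (T - T0)\<^sup>2 + 4 * (1 - cos (s - s0))"
proof -
  have "(dist (r_mat (abs_circle s)) (r_mat (abs_circle s0)))\<^sup>2 =
      2 * (cos s - cos s0)\<^sup>2 + 2 * (sin s - sin s0)\<^sup>2"
    by (simp add: dist_norm power2_norm_eq_inner inner_vec_def sum_2 r_mat_eq_lambda)
      (simp add: power2_eq_square algebra_simps)
  also have "\<dots> = 2 * ((sin s)\<^sup>2 + (cos s)\<^sup>2) + 2 * ((sin s0)\<^sup>2 + (cos s0)\<^sup>2) -
      4 * (cos s * cos s0 + sin s * sin s0)"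
    by algebra
  also have "\<dots> = 4 * (1 - cos (s - s0))"
    by (simp only: sin_cos_squared_add cos_diff) simp
  finally show ?thesis
    by (simp add: dist_Pair_Pair dist_real_def)
qed

text \<open>Here \<open>e\<close> stands for the square of the radius of the bump.\<close>

lemma smooth_bump:
  "smooth (\<lambda>(T, s). flat 0 (e - ((T - T0)\<^sup>2 + 4 * (1 - cos (s - s0)))) * c)"
proof -
  have fst: "elementary (fst :: real \<times> real \<Rightarrow> real)" and snd: "elementary (snd :: real \<times> real \<Rightarrow> real)"
    by (auto intro: elementary.linear bounded_linear_fst bounded_linear_snd)
  show ?thesis
    unfolding case_prod_unfold power2_eq_square
    by (intro elementary_imp_smooth elementary_closed elementary_diff fst snd)
qed

text \<open>The density is a multiple of \<open>flat 0\<close> applied to squared radius minus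
  squared distance, hence positive exactly on the ball. Normalisation requires its total mass
  \<open>Z\<close> on the strip to be finite and nonzero.\<close>

lemma ex_smooth_prob_measure_near:
  assumes I: "compact_circle_interval I" and "\<theta>0 \<in> I" "T0 \<ge> 1" "e > 0"
  obtains \<pi> where "\<pi> \<in> smooth_prob_measures I"
    and "AE p in \<pi>. dist (fst p, r_mat (snd p)) (T0, r_mat \<theta>0) < e"
proof -
  define f where "f p = flat 0 (e\<^sup>2 - (dist (fst p, r_mat (snd p)) (T0, r_mat \<theta>0))\<^sup>2)" for p
  have f_pos_iff: "f p > 0 \<longleftrightarrow> dist (fst p, r_mat (snd p)) (T0, r_mat \<theta>0) < e" for p
    using \<open>e > 0\<close> by (auto simp: f_def flat_pos_iff power2_less_imp_less intro: power_strict_mono)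
  have f_nonneg: "f p \<ge> 0" and f_le_1: "f p \<le> 1" for p
    by (auto simp: f_def flat_nonneg flat_0_le_1)
  have "continuous_on UNIV (flat 0)"
    using flat_has_real_derivative[of 0]
    by (intro continuous_at_imp_continuous_on) (auto intro: DERIV_isCont)
  then have "continuous_on UNIV f"
    unfolding f_def
    by (rule continuous_on_compose2)
      (auto intro!: continuous_intros continuous_on_compose2[OF continuous_on_r_mat[of UNIV]])
  then have f_borel: "f \<in> borel_measurable borel"
    by (rule borel_measurable_continuous_onI)

  let ?S = "{1..} \<times> I :: (real \<times> circle) set"
  define L :: "(real \<times> circle) measure" where "L = lborel \<Otimes>\<^sub>M circle_lebesgue"
  define M where "M = restrict_space L ?S"
  have sets_L [measurable_cong]: "sets L = sets borel"
    by (simp add: L_def sets_lborel_circle)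
  have [measurable]: "f \<in> borel_measurable L"
    using f_borel by measurable
  have "closed ?S"
    by (intro closed_Times closed_atLeast compact_imp_closed compact_circle_interval_compact I)
  then have [measurable]: "?S \<in> sets L"
    by (simp add: sets_L)
  have [measurable]: "f \<in> borel_measurable M"
    unfolding M_def by (intro measurable_restrict_space1) simp
  have emeasure_Times: "emeasure L (A \<times> B) = emeasure lborel A * emeasure circle_lebesgue B"
    if "A \<in> sets borel" "B \<in> sets borel" for A B
    unfolding L_def using that by (intro circle_lebesgue.emeasure_pair_measure_Times) auto

  define Z where "Z = (\<integral>\<^sup>+p. f p \<partial>M)"
  have Z_eq: "Z = (\<integral>\<^sup>+p. ennreal (f p) * indicator ?S p \<partial>L)"
    unfolding Z_def M_def by (rule nn_integral_restrict_space) simp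
  have near: "\<bar>fst p - T0\<bar> < e" if "f p > 0" for p
    using that dist_fst_le[of "(fst p, r_mat (snd p))" "(T0, r_mat \<theta>0)"]
    by (simp add: f_pos_iff dist_real_def)
  \<comment> \<open>The bump is at most 1 and vanishes unless the time is within \<open>e\<close> of
    \<open>T0\<close>, so a rectangle of finite measure dominates it.\<close>
  have "Z \<le> (\<integral>\<^sup>+p. indicator ({1..T0 + e} \<times> UNIV) p \<partial>L)"
    unfolding Z_eq
  proof (rule nn_integral_mono)
    fix p :: "real \<times> circle"
    show "ennreal (f p) * indicator ?S p \<le> indicator ({1..T0 + e} \<times> UNIV) p"
      using near[of p] f_le_1[of p] f_nonneg[of p]
      by (cases "f p = 0"; cases p) (auto simp: indicator_def)
  qed
  also have "\<dots> = emeasure lborel {1..T0 + e} * emeasure circle_lebesgue UNIV"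
    by (simp add: emeasure_Times sets_L borel_Times)
  also have "\<dots> < \<infinity>"
    using assms by (simp add: ennreal_mult_eq_top_iff flip: less_top)
  finally have Z_fin: "Z < \<infinity>" .

  \<comment> \<open>Keeping both the time difference and the matrix distance below
    \<open>e / 2\<close> keeps the product distance below \<open>e\<close>.\<close>
  have "open {\<theta>. dist (r_mat \<theta>) (r_mat \<theta>0) < e / 2}"
    by (rule open_Collect_less[OF continuous_on_dist[OF continuous_on_r_mat continuous_on_const]
          continuous_on_const])
  moreover have "\<theta>0 \<in> {\<theta>. dist (r_mat \<theta>) (r_mat \<theta>0) < e / 2}"
    using \<open>e > 0\<close> by simp
  ultimately obtain V where V: "open V" "V \<noteq> {}"
      "V \<subseteq> {\<theta>. dist (r_mat \<theta>) (r_mat \<theta>0) < e / 2} \<inter> I"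
    by (rule open_meets_interior_circle_interval[OF I _ _ \<open>\<theta>0 \<in> I\<close>])
  \<comment> \<open>A rectangle of positive measure inside both the ball and the strip. It extends
    only to the right of \<open>T0\<close>, which may be the boundary value 1, and \<open>V\<close>
    need not contain \<open>\<theta>0\<close>, which may be an endpoint.\<close>
  let ?W = "{T0..<T0 + e / 2} \<times> V"
  have W: "?W \<subseteq> {p \<in> space L. ennreal (f p) * indicator ?S p \<noteq> 0}"
  proof clarify
    fix T \<theta> assume "T \<in> {T0..<T0 + e / 2}" "\<theta> \<in> V"
    then have "dist (T, r_mat \<theta>) (T0, r_mat \<theta>0) < e" "\<theta> \<in> I" "T \<ge> 1"
      using V \<open>T0 \<ge> 1\<close>
      by (auto simp: dist_Pair_Pair dist_real_def intro!: sqrt_sum_squares_half_less)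
    then have "f (T, \<theta>) > 0" "(T, \<theta>) \<in> ?S"
      by (auto simp: f_pos_iff)
    then show "(T, \<theta>) \<in> space L \<and> ennreal (f (T, \<theta>)) * indicator ?S (T, \<theta>) \<noteq> 0"
      using sets_eq_imp_space_eq[OF sets_L] by auto
  qed
  have "Z \<noteq> 0"
  proof
    assume "Z = 0"
    then have "emeasure L {p \<in> space L. ennreal (f p) * indicator ?S p \<noteq> 0} = 0"
      unfolding Z_eq by (subst (asm) nn_integral_0_iff) auto
    moreover have "emeasure L ?W \<le> emeasure L {p \<in> space L. ennreal (f p) * indicator ?S p \<noteq> 0}"
      by (intro emeasure_mono W) measurable
    moreover have "emeasure L ?W > 0"
      using \<open>e > 0\<close> V emeasure_circle_lebesgue_open[of V]
      by (subst emeasure_Times) (auto simp: ennreal_zero_less_mult_iff)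
    ultimately show False by simp
  qed

  define z where "z = enn2real Z"
  have z: "z > 0" "Z = ennreal z"
    using Z_fin \<open>Z \<noteq> 0\<close> by (auto simp: z_def enn2real_positive_iff less_top zero_less_iff_neq_zero)
  define \<rho> where "\<rho> p = f p * (1 / z)" for p
  define \<pi> where "\<pi> = density M (\<lambda>p. ennreal (\<rho> p))"
  have \<rho>_pos_iff: "\<rho> p > 0 \<longleftrightarrow> f p > 0" for p
    using z by (auto simp: \<rho>_def zero_less_mult_iff zero_less_divide_iff)
  have \<rho>_borel: "(\<lambda>p. ennreal (\<rho> p)) \<in> borel_measurable M"
    unfolding \<rho>_def by measurable
  have AE_\<pi>: "AE p in \<pi>. p \<in> ?S \<and> f p > 0"
    unfolding \<pi>_def by (subst AE_density[OF \<rho>_borel])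
      (auto simp: \<rho>_pos_iff M_def space_restrict_space intro!: AE_I2)
  have "emeasure \<pi> (space \<pi>) = (\<integral>\<^sup>+p. ennreal (\<rho> p) \<partial>M)"
    unfolding \<pi>_def by (subst emeasure_density[OF \<rho>_borel]) (auto intro!: nn_integral_cong)
  also have "\<dots> = Z * ennreal (1 / z)"
  proof -
    have "ennreal (\<rho> p) = ennreal (f p) * ennreal (1 / z)" for p
      unfolding \<rho>_def using z f_nonneg by (intro ennreal_mult) auto
    then show ?thesis
      by (simp add: Z_def nn_integral_multc)
  qed
  also have "\<dots> = 1"
    unfolding z(2) using z(1) by (subst ennreal_mult[symmetric]) auto
  finally have "prob_space \<pi>"
    by (rule prob_spaceI)
  moreover have "smooth_on_strip I \<rho>"
  proof -
    \<comment> \<open>In a lifted angle the formula for the density makes sense for all real times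
      and angles, so it serves as its own smooth extension.\<close>
    obtain s0 where "\<theta>0 = abs_circle s0" by (rule abs_circle_surj)
    then have "\<rho> (T, abs_circle s) =
        (\<lambda>(T, s). flat 0 (e\<^sup>2 - ((T - T0)\<^sup>2 + 4 * (1 - cos (s - s0)))) * (1 / z)) (T, s)" for T s
      by (simp add: \<rho>_def f_def dist_r_mat)
    then show ?thesis
      unfolding smooth_on_strip_def using smooth_bump by blast
  qed
  moreover have "\<forall>p\<in>?S. 0 \<le> \<rho> p"
    using z f_nonneg by (simp add: \<rho>_def)
  moreover have "compact ({1..T0 + e} \<times> I)" "{1..T0 + e} \<times> I \<subseteq> ?S"
    using compact_circle_interval_compact[OF I] by (auto intro: compact_Times)
  moreover have "AE p in \<pi>. p \<in> {1..T0 + e} \<times> I"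
    using AE_\<pi> by eventually_elim (auto dest!: near)
  ultimately have "\<pi> \<in> smooth_prob_measures I"
    unfolding smooth_prob_measures_def mem_Collect_eq \<pi>_def M_def L_def by blast
  moreover have "AE p in \<pi>. dist (fst p, r_mat (snd p)) (T0, r_mat \<theta>0) < e"
    using AE_\<pi> by eventually_elim (simp add: f_pos_iff)
  ultimately show ?thesis
    by (rule that)
qed

section \<open>Escape to the point at infinity of the compactified strip\<close>

lemma space_borel_of: "space (borel_of S) = topspace S"
  unfolding borel_of_def by (rule space_measure_of) (auto dest: openin_subset)

lemma sets_borel_of: "openin S U \<Longrightarrow> U \<in> sets (borel_of S)"
  unfolding borel_of_def by (subst sets_measure_of) (auto dest: openin_subset)

lemma borel_measurable_continuous_map:
  assumes "continuous_map S euclideanreal \<phi>"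
  shows "\<phi> \<in> borel_measurable (borel_of S)"
proof (rule borel_measurableI)
  fix U :: "real set" assume "open U"
  then have "openin S {y \<in> topspace S. \<phi> y \<in> U}"
    using assms by (auto intro: openin_continuous_map_preimage)
  moreover have "\<phi> -` U \<inter> space (borel_of S) = {y \<in> topspace S. \<phi> y \<in> U}"
    by (auto simp: space_borel_of)
  ultimately show "\<phi> -` U \<inter> space (borel_of S) \<in> sets (borel_of S)"
    by (simp add: sets_borel_of)
qed

text \<open>Time is bounded on every compact part of the strip, so measures living at times at least
  \<open>T n - 1\<close> eventually give it no mass. A continuous function is nearly
  \<open>\<phi> None\<close> off a suitable compact part.\<close>

lemma tends_to_dirac_infinityI:
  assumes \<pi>: "\<And>n. \<pi> n \<in> smooth_prob_measures I"
    and near: "\<And>n. AE p in \<pi> n. T n \<le> fst p + 1"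
    and T: "filterlim T at_top sequentially"
  shows "tends_to_dirac_infinity I \<pi>"
  unfolding tends_to_dirac_infinity_def weak_star_conv_def
proof (intro allI impI, elim conjE)
  let ?S = "S_compactification I"
  fix \<phi> assume \<phi>: "continuous_map ?S euclideanreal \<phi>"
  have [measurable]: "\<phi> \<in> borel_measurable (borel_of ?S)"
    using \<phi> by (rule borel_measurable_continuous_map)
  have Some: "Some \<in> \<pi> n \<rightarrow>\<^sub>M borel_of ?S" for n
    unfolding borel_of_def
  proof (rule measurable_measure_of)
    show "Some \<in> space (\<pi> n) \<rightarrow> topspace ?S"
      by (auto simp: space_smooth_prob_measure[OF \<pi>])
    fix U assume "U \<in> {U. openin ?S U}"
    then have "openin (top_of_set ({1..} \<times> I)) {p \<in> {1..} \<times> I. Some p \<in> U}"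
      using openin_continuous_map_preimage[OF continuous_map_Some] by fastforce
    then obtain O' where "open O'" "{p \<in> {1..} \<times> I. Some p \<in> U} = ({1..} \<times> I) \<inter> O'"
      by (auto simp: openin_open)
    moreover have "Some -` U \<inter> space (\<pi> n) = {p \<in> {1..} \<times> I. Some p \<in> U}"
      by (auto simp: space_smooth_prob_measure[OF \<pi>])
    ultimately show "Some -` U \<inter> space (\<pi> n) \<in> sets (\<pi> n)"
      by (auto simp: sets_smooth_prob_measure[OF \<pi>] sets_restrict_space)
  qed (auto dest!: openin_subset simp del: topspace_Alexandroff_compactification)
  have "(\<lambda>n. \<integral>p. \<phi> (Some p) \<partial>\<pi> n) \<longlonglongrightarrow> \<phi> None"
  proof (rule LIMSEQ_I)
    fix r :: real assume "r > 0"
    \<comment> \<open>The radius \<open>r / 2\<close> leaves room for the strict inequality at the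
      end, since averaging only preserves the weak one. Neighbourhoods of \<open>None\<close> are
      complements of compact sets, which yields \<open>C\<close>.\<close>
    have "openin ?S {y \<in> topspace ?S. \<phi> y \<in> ball (\<phi> None) (r / 2)}"
      by (rule openin_continuous_map_preimage[OF \<phi>]) simp
    moreover have "None \<in> {y \<in> topspace ?S. \<phi> y \<in> ball (\<phi> None) (r / 2)}"
      using \<open>r > 0\<close> by simp
    ultimately obtain C where C: "compactin (top_of_set ({1..} \<times> I)) C"
        "{y \<in> topspace ?S. \<phi> y \<in> ball (\<phi> None) (r / 2)} =
          insert None (Some ` (topspace (top_of_set ({1..} \<times> I)) - C))"
      unfolding openin_Alexandroff_compactification by blast
    have "compact (fst ` C)"
      using C(1) by (auto simp: compactin_subtopology intro!: compact_continuous_image continuous_intros)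
    then obtain b where b: "\<And>p. p \<in> C \<Longrightarrow> fst p \<le> b"
      using bounded_imp_bdd_above[OF compact_imp_bounded] unfolding bdd_above_def by (metis imageI)
    have small: "\<bar>\<phi> (Some p) - \<phi> None\<bar> \<le> r / 2" if "p \<in> {1..} \<times> I" "p \<notin> C" for p
    proof -
      have "Some p \<in> {y \<in> topspace ?S. \<phi> y \<in> ball (\<phi> None) (r / 2)}"
        using that unfolding C(2) by simp
      then show ?thesis
        by (simp add: dist_real_def abs_minus_commute)
    qed
    \<comment> \<open>The extra 1 absorbs the slack allowed in \<open>near\<close>, so that the time
      coordinate really exceeds \<open>b\<close>.\<close>
    obtain N where N: "\<And>n. n \<ge> N \<Longrightarrow> T n > b + 1"
      using T unfolding filterlim_at_top_dense eventually_sequentially by metis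
    have "norm ((\<integral>p. \<phi> (Some p) \<partial>\<pi> n) - \<phi> None) < r" if "n \<ge> N" for n
    proof -
      interpret prob_space "\<pi> n" using \<pi>[of n] by (simp add: smooth_prob_measures_def)
      have "AE p in \<pi> n. p \<in> {1..} \<times> I"
        by (intro AE_I2) (simp add: space_smooth_prob_measure[OF \<pi>])
      with near[of n] have "AE p in \<pi> n. \<bar>\<phi> (Some p) - \<phi> None\<bar> \<le> r / 2"
      proof eventually_elim
        case (elim p)
        then have "p \<notin> C" using N[OF that] b[of p] by auto
        with elim show ?case by (intro small)
      qed
      moreover have "(\<lambda>p. \<phi> (Some p)) \<in> borel_measurable (\<pi> n)"
        using Some by (rule measurable_compose) simp
      ultimately have "\<bar>(\<integral>p. \<phi> (Some p) \<partial>\<pi> n) - \<phi> None\<bar> \<le> r / 2"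
        by (intro expectation_close)
      then show ?thesis using \<open>r > 0\<close> by simp
    qed
    then show "\<exists>N. \<forall>n\<ge>N. norm ((\<integral>p. \<phi> (Some p) \<partial>\<pi> n) - \<phi> None) < r"
      by blast
  qed
  moreover have "(\<integral>y. \<phi> y \<partial>distr (\<pi> n) (borel_of ?S) Some) = (\<integral>p. \<phi> (Some p) \<partial>\<pi> n)" for n
    using Some by (intro integral_distr) auto
  moreover have "(\<integral>y. \<phi> y \<partial>return (borel_of ?S) None) = \<phi> None"
    by (intro integral_return) (auto simp: space_borel_of)
  ultimately show "(\<lambda>n. \<integral>y. \<phi> y \<partial>distr (\<pi> n) (borel_of ?S) Some)
      \<longlonglongrightarrow> (\<integral>y. \<phi> y \<partial>return (borel_of ?S) None)"
    by simp
qed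

section \<open>From averaged measures to individual orbits\<close>

theorem corollary1p8:
  fixes act :: "real^2^2 \<Rightarrow> 'x::{second_countable_topology, t2_space} \<Rightarrow> 'x"
    and x :: 'x
    and I :: "circle set"
    and \<mu> :: "'x measure"
  assumes "locally_compact_space (euclidean :: 'x topology)"
    and "continuous_SL2R_action act"
    and "compact_circle_interval I"
    and "sets \<mu> = sets borel"
    and "\<And>\<pi>. \<lbrakk>\<And>n. \<pi> n \<in> smooth_prob_measures I; tends_to_dirac_infinity I \<pi>\<rbrakk> \<Longrightarrow>
           weak_star_conv euclidean (\<lambda>n. averaged_measure act x (\<pi> n)) \<mu> sequentially"
    and "prob_space \<mu>"
    and "flow_ergodic (\<lambda>t. act (g_mat t)) \<mu>"
  shows "AE \<theta> in circle_lebesgue. \<theta> \<in> I \<longrightarrow>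
           weak_star_conv euclidean (\<lambda>T. orbit_average act x T \<theta>) \<mu> at_top"
proof (intro AE_I2 impI)
  fix \<theta> assume "\<theta> \<in> I"
  show "weak_star_conv euclidean (\<lambda>T. orbit_average act x T \<theta>) \<mu> at_top"
    unfolding weak_star_conv_def
  \<comment> \<open>Convergence over real times is tested along arbitrary sequences \<open>X\<close>
    tending to infinity.\<close>
  proof (intro allI impI, rule tendsto_at_topI_sequentially)
    fix \<phi> :: "'x \<Rightarrow> real" and X :: "nat \<Rightarrow> real"
    assume \<phi>: "continuous_map euclidean euclideanreal \<phi> \<and>
        (\<exists>K. compactin euclidean K \<and> (\<forall>y\<in>topspace euclidean - K. \<phi> y = 0))"
      and X: "filterlim X at_top sequentially"
    have cont: "continuous_on UNIV \<phi>"
      using \<phi> by simp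
    obtain K where K: "compact K" "\<And>y. y \<notin> K \<Longrightarrow> \<phi> y = 0"
      using \<phi> by auto
    \<comment> \<open>A continuous function of compact support is bounded, as the iterated
      integration formula requires.\<close>
    have "bounded (\<phi> ` K)"
      using K(1) cont by (intro compact_imp_bounded compact_continuous_image)
        (auto intro: continuous_on_subset)
    then obtain B where "\<And>y. y \<in> K \<Longrightarrow> \<bar>\<phi> y\<bar> \<le> B" "B > 0"
      unfolding bounded_pos by auto
    then have bound: "\<bar>\<phi> y\<bar> \<le> B" for y
      using K(2)[of y] by (cases "y \<in> K") auto

    let ?G = "time_average act x \<phi>"
    \<comment> \<open>Truncation at 1 places every \<open>T n\<close> in the strip and changes only
      finitely many terms of \<open>X\<close>.\<close>
    define T where "T n = max 1 (X n)" for n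
    have X_eq_T: "eventually (\<lambda>n. X n = T n) sequentially"
      using X[unfolded filterlim_at_top, rule_format, of 1] by eventually_elim (simp add: T_def)
    have T: "filterlim T at_top sequentially"
      using X by (rule filterlim_at_top_mono) (simp add: T_def)
    have G_cont: "continuous_on (UNIV \<times> SL2R) ?G"
      using assms(2) cont by (rule continuous_on_time_average)
    have "\<forall>n. \<exists>\<pi>. \<pi> \<in> smooth_prob_measures I \<and> (AE p in \<pi>. T n \<le> fst p + 1) \<and>
        (AE p in \<pi>. \<bar>?G (fst p, r_mat (snd p)) - ?G (T n, r_mat \<theta>)\<bar> \<le> 1 / real (Suc n))"
    proof
      fix n
      obtain d where d: "d > 0" "\<And>z. z \<in> UNIV \<times> SL2R \<Longrightarrow> dist z (T n, r_mat \<theta>) < d \<Longrightarrow>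
          dist (?G z) (?G (T n, r_mat \<theta>)) < 1 / real (Suc n)"
        using G_cont[unfolded continuous_on_iff, rule_format, of "(T n, r_mat \<theta>)" "1 / real (Suc n)"]
        by (auto simp: r_mat_SL2R)
      \<comment> \<open>Radius at most \<open>d\<close> controls the oscillation of
        \<open>?G\<close> on the bump; radius at most 1 gives the lower bound on time needed for
        escape to infinity.\<close>
      obtain \<pi> where \<pi>: "\<pi> \<in> smooth_prob_measures I"
          "AE p in \<pi>. dist (fst p, r_mat (snd p)) (T n, r_mat \<theta>) < min d 1"
        using ex_smooth_prob_measure_near[OF assms(3) \<open>\<theta> \<in> I\<close>, of "T n" "min d 1"] d(1)
        by (auto simp: T_def)
      have "AE p in \<pi>. T n \<le> fst p + 1"
        using \<pi>(2)
      proof eventually_elim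
        case (elim p)
        then show ?case
          using dist_fst_le[of "(fst p, r_mat (snd p))" "(T n, r_mat \<theta>)"]
          by (auto simp: dist_real_def abs_le_iff)
      qed
      moreover have "AE p in \<pi>. \<bar>?G (fst p, r_mat (snd p)) - ?G (T n, r_mat \<theta>)\<bar> \<le> 1 / real (Suc n)"
        using \<pi>(2)
      proof eventually_elim
        case (elim p)
        then show ?case
          using d(2)[of "(fst p, r_mat (snd p))"] by (simp add: dist_real_def r_mat_SL2R)
      qed
      ultimately show "\<exists>\<pi>. \<pi> \<in> smooth_prob_measures I \<and> (AE p in \<pi>. T n \<le> fst p + 1) \<and>
          (AE p in \<pi>. \<bar>?G (fst p, r_mat (snd p)) - ?G (T n, r_mat \<theta>)\<bar> \<le> 1 / real (Suc n))"
        using \<pi>(1) by blast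
    qed
    from choice[OF this] obtain \<pi> where \<pi>: "\<And>n. \<pi> n \<in> smooth_prob_measures I"
      and far: "\<And>n. AE p in \<pi> n. T n \<le> fst p + 1"
      and close: "\<And>n. AE p in \<pi> n.
        \<bar>?G (fst p, r_mat (snd p)) - ?G (T n, r_mat \<theta>)\<bar> \<le> 1 / real (Suc n)"
      by blast
    have "tends_to_dirac_infinity I \<pi>"
      using \<pi> far T by (rule tends_to_dirac_infinityI)
    with \<pi> have "weak_star_conv euclidean (\<lambda>n. averaged_measure act x (\<pi> n)) \<mu> sequentially"
      by (rule assms(5))
    then have "(\<lambda>n. \<integral>y. \<phi> y \<partial>averaged_measure act x (\<pi> n)) \<longlonglongrightarrow> (\<integral>y. \<phi> y \<partial>\<mu>)"
      using \<phi> unfolding weak_star_conv_def by blast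
    then have lim: "(\<lambda>n. \<integral>p. ?G (fst p, r_mat (snd p)) \<partial>\<pi> n) \<longlonglongrightarrow> (\<integral>y. \<phi> y \<partial>\<mu>)"
      by (simp add: integral_averaged_measure[OF assms(2) \<pi> cont bound])
    have "continuous_on UNIV (\<lambda>p. ?G (fst p, r_mat (snd p)))"
      by (rule continuous_on_compose2[OF G_cont])
        (auto simp: r_mat_SL2R intro!: continuous_intros
          continuous_on_compose2[OF continuous_on_r_mat[of UNIV]])
    then have G_borel: "(\<lambda>p. ?G (fst p, r_mat (snd p))) \<in> borel_measurable borel"
      by (rule borel_measurable_continuous_onI)
    have "\<bar>(\<integral>p. ?G (fst p, r_mat (snd p)) \<partial>\<pi> n) - ?G (T n, r_mat \<theta>)\<bar> \<le> 1 / real (Suc n)" for n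
    proof -
      interpret prob_space "\<pi> n" using \<pi>[of n] by (simp add: smooth_prob_measures_def)
      show ?thesis
        using measurable_smooth_prob_measure[OF \<pi> G_borel] close by (rule expectation_close)
    qed
    \<comment> \<open>The bump averages and the values at the bump centres differ by a null
      sequence, so the limit passes to the centres.\<close>
    then have "(\<lambda>n. (\<integral>p. ?G (fst p, r_mat (snd p)) \<partial>\<pi> n) - ?G (T n, r_mat \<theta>)) \<longlonglongrightarrow> 0"
      by (intro Lim_null_comparison[OF _ LIMSEQ_Suc[OF lim_1_over_n]]) (simp del: of_nat_Suc)
    from tendsto_diff[OF lim this] have "(\<lambda>n. ?G (T n, r_mat \<theta>)) \<longlonglongrightarrow> (\<integral>y. \<phi> y \<partial>\<mu>)"
      by simp
    \<comment> \<open>Eventually \<open>X n = T n\<close>, so the values at the centres are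
      integrals against the original orbit averages.\<close>
    moreover have "eventually (\<lambda>n. ?G (T n, r_mat \<theta>) =
        (\<integral>y. \<phi> y \<partial>orbit_average act x (X n) \<theta>)) sequentially"
      using X_eq_T
    proof eventually_elim
      case (elim n)
      moreover have "T n > 0" by (simp add: T_def)
      ultimately show ?case
        using integral_orbit_average[OF assms(2) _ cont] by simp
    qed
    ultimately show "(\<lambda>n. \<integral>y. \<phi> y \<partial>orbit_average act x (X n) \<theta>) \<longlonglongrightarrow> (\<integral>y. \<phi> y \<partial>\<mu>)"
      by (rule Lim_transform_eventually)
  qed
qed

end
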